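(* Let $X$ be a real normed space with $\dim X\ge2$, let $\lambda\in\Lambda_m$ and $1\le p\le\infty$. If $$\mathfrak{C}_{\lambda,p}(X)<2^{1-1/p},$$ then $X$ is uniformly non-square. Conversely, if $\lambda\in\Lambda_m$ is strictly increasing in each variable and $X$ is uniformly non-square, then $$\mathfrak{C}_{\lambda,p}(X)<2^{1-1/p}$$ for every $1<p<\infty$.
   Context: $\Lambda$ is the class of all continuous functions $\lambda:[0,\infty)^2\to[0,\infty)$ that are homogeneous of degree one and satisfy $\lambda(1,1)=1$. $\Lambda_m$ is the set of $\lambda\in\Lambda$ that are non-decreasing in each variable. $S_X$ is the unit sphere of $X$. For $(r,s)\in\mathbb{R}^2$, $\|(r,s)\|_p=(|r|^p+|s|^p)^{1/p}$ if $1\le p<\infty$ and $\|(r,s)\|_\infty=\max\{|r|,|s|\}$; $1/\infty=0$. Define $$\mathfrak{C}_{\lambda,p}(X)=\sup\{\lambda(\|ru+sv\|,\|su-rv\|):u,v\in S_X,\ r,s\ge0,\ \|(r,s)\|_p=1\}.$$ $X$ is uniformly non-square if there is $\delta<2$ such that $\min\{\|x+y\|,\|x-y\|\}\le\delta$ for all $x,y\in S_X$. *)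

theory Defs
  imports "HOL-Analysis.Analysis"
begin

definition Lambda_class :: "(real \<times> real \<Rightarrow> real) set" where
  "Lambda_class = {f. continuous_on ({0..} \<times> {0..}) f
     \<and> (\<forall>a\<ge>0. \<forall>b\<ge>0. f (a, b) \<ge> 0)
     \<and> (\<forall>t\<ge>0. \<forall>a\<ge>0. \<forall>b\<ge>0. f (t * a, t * b) = t * f (a, b))
     \<and> f (1, 1) = 1}"

definition Lambda_mono :: "(real \<times> real \<Rightarrow> real) set" where
  "Lambda_mono = {f \<in> Lambda_class.
     \<forall>c\<ge>0. mono_on {0..} (\<lambda>a. f (a, c)) \<and> mono_on {0..} (\<lambda>b. f (c, b))}"

definition strictly_increasing_each :: "(real \<times> real \<Rightarrow> real) \<Rightarrow> bool" where
  "strictly_increasing_each f \<longleftrightarrow>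
     (\<forall>c\<ge>0. strict_mono_on {0..} (\<lambda>a. f (a, c)) \<and> strict_mono_on {0..} (\<lambda>b. f (c, b)))"

definition pnorm :: "ereal \<Rightarrow> real \<times> real \<Rightarrow> real" where
  "pnorm p = (\<lambda>(r, s). if p = \<infinity> then max \<bar>r\<bar> \<bar>s\<bar>
     else (\<bar>r\<bar> powr real_of_ereal p + \<bar>s\<bar> powr real_of_ereal p) powr (1 / real_of_ereal p))"

definition constant_values ::
    "(real \<times> real \<Rightarrow> real) \<Rightarrow> ereal \<Rightarrow> 'a::real_normed_vector itself \<Rightarrow> real set" where
  "constant_values f p _ =
     {f (norm (r *\<^sub>R u + s *\<^sub>R v), norm (s *\<^sub>R u - r *\<^sub>R v)) | (u :: 'a) v r s.
        u \<in> sphere 0 1 \<and> v \<in> sphere 0 1 \<and> r \<ge> 0 \<and> s \<ge> 0 \<and> pnorm p (r, s) = 1}"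

text \<open>The real-valued supremum is meaningful for nontrivial spaces, \<open>f\<close> in the class and
  \<open>p \<ge> 1\<close>; see the two lemmas following the definition.\<close>

definition frak_C ::
    "(real \<times> real \<Rightarrow> real) \<Rightarrow> ereal \<Rightarrow> 'a::real_normed_vector itself \<Rightarrow> real" where
  "frak_C f p X = Sup (constant_values f p X)"

lemma constant_values_nonempty:
  assumes "\<exists>x :: 'a::real_normed_vector. x \<noteq> 0" "1 \<le> p"
  shows "constant_values f p TYPE('a) \<noteq> {}"
proof -
  obtain x :: 'a where "x \<noteq> 0" using assms by blast
  then have 1: "x /\<^sub>R norm x \<in> sphere 0 1" by simp
  have 2: "pnorm p (1, 0) = 1" by (auto simp: pnorm_def)
  show ?thesis unfolding constant_values_def using 1 2 zero_le_one by blast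
qed

lemma pnorm_eq_1_le:
  assumes "1 \<le> p" "0 \<le> r" "0 \<le> s" "pnorm p (r, s) = 1"
  shows "r \<le> 1 \<and> s \<le> 1"
proof (cases "p = \<infinity>")
  case True
  then show ?thesis using assms by (auto simp: pnorm_def)
next
  case False
  then obtain q where q: "p = ereal q" "1 \<le> q" using assms(1) by (cases p) auto
  have "(r powr q + s powr q) powr (1 / q) = 1" using assms q by (simp add: pnorm_def)
  then have "((r powr q + s powr q) powr (1 / q)) powr q = 1" by simp
  then have sum: "r powr q + s powr q = 1" using q by (simp add: powr_powr)
  have "x \<le> 1" if "0 \<le> x" "x powr q \<le> 1" for x
  proof (rule ccontr)
    assume "\<not> x \<le> 1"
    then have "1 < x powr q" using q powr_less_mono2[of q 1 x] by simp
    with that show False by simp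
  qed
  moreover have "r powr q \<le> 1" "s powr q \<le> 1"
    using sum powr_ge_zero[of r q] powr_ge_zero[of s q] by linarith+
  ultimately show ?thesis using assms by blast
qed

lemma constant_values_bdd_above:
  assumes "f \<in> Lambda_class" "1 \<le> p"
  shows "bdd_above (constant_values f p TYPE('a::real_normed_vector))"
proof -
  have "continuous_on ({0..2} \<times> {0..2}) f"
    by (rule continuous_on_subset[of "{0..} \<times> {0..}"]) (use assms in \<open>auto simp: Lambda_class_def\<close>)
  then have "compact (f ` ({0..2} \<times> {0..2}))"
    by (intro compact_continuous_image compact_Times) auto
  then have bdd: "bdd_above (f ` ({0..2} \<times> {0..2}))"
    by (intro bounded_imp_bdd_above compact_imp_bounded)
  have "constant_values f p TYPE('a) \<subseteq> f ` ({0..2} \<times> {0..2})"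
  proof
    fix y assume "y \<in> constant_values f p TYPE('a)"
    then obtain u v :: 'a and r s where y:
      "y = f (norm (r *\<^sub>R u + s *\<^sub>R v), norm (s *\<^sub>R u - r *\<^sub>R v))"
      "norm u = 1" "norm v = 1" "0 \<le> r" "0 \<le> s" "pnorm p (r, s) = 1"
      by (auto simp: constant_values_def)
    then have "r \<le> 1 \<and> s \<le> 1" using pnorm_eq_1_le assms by blast
    then have "norm (r *\<^sub>R u + s *\<^sub>R v) \<le> 2" "norm (s *\<^sub>R u - r *\<^sub>R v) \<le> 2"
      using y norm_triangle_ineq[of "r *\<^sub>R u" "s *\<^sub>R v"]
        norm_triangle_ineq4[of "s *\<^sub>R u" "r *\<^sub>R v"] by auto
    then show "y \<in> f ` ({0..2} \<times> {0..2})" using y by auto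
  qed
  with bdd show ?thesis by (rule bdd_above_mono)
qed

definition uniformly_nonsquare :: "'a::real_normed_vector itself \<Rightarrow> bool" where
  "uniformly_nonsquare _ \<longleftrightarrow>
     (\<exists>\<delta><2. \<forall>x\<in>sphere (0 :: 'a) 1. \<forall>y\<in>sphere 0 1. min (norm (x + y)) (norm (x - y)) \<le> \<delta>)"

end

(* If X is not uniformly non-square, nearly square pairs u, v together with r = s = 2^(-1/p)
   push the constant up to 2^(1-1/p).
   Conversely let delta < 2 witness uniform non-squareness. The larger of the two norms is at
   most r + s and the smaller one at most d = min(r,s) * delta + |r - s|, so the constant is
   bounded by the maximum over the compact arc of (r,s) with p-norm one of the continuous
   function max(f(r+s,d), f(d,r+s)). This function is at most r + s, which is smaller than
   2^(1-1/p) off the diagonal, by strict convexity of the p-th power; on the diagonal d < r + s,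
   and strict monotonicity of f yields the strict inequality. *)

theory Submission
  imports Defs
begin

lemma Lambda_mono_le:
  assumes "f \<in> Lambda_mono" "0 \<le> a" "a \<le> a'" "0 \<le> b" "b \<le> b'"
  shows "f (a, b) \<le> f (a', b')"
proof -
  have m: "mono_on {0..} (\<lambda>a. f (a, c))" "mono_on {0..} (\<lambda>b. f (c, b))" if "c \<ge> 0" for c
    using assms(1) that by (auto simp: Lambda_mono_def)
  have "f (a, b) \<le> f (a', b)"
    using mono_onD[OF m(1)[of b], of a a'] assms by simp
  also have "\<dots> \<le> f (a', b')"
    using mono_onD[OF m(2)[of a'], of b b'] assms by simp
  finally show ?thesis .
qed

lemma Lambda_class_diag:
  assumes "f \<in> Lambda_class" "0 \<le> t"
  shows "f (t, t) = t"
proof -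
  have "f (t * 1, t * 1) = t * f (1, 1)" "f (1, 1) = 1"
    using assms unfolding Lambda_class_def by (blast intro: zero_le_one)+
  then show ?thesis by simp
qed

lemma pnorm_ereal_eq_1_iff:
  assumes "0 < q" "0 \<le> r" "0 \<le> s"
  shows "pnorm (ereal q) (r, s) = 1 \<longleftrightarrow> r powr q + s powr q = 1"
proof
  assume "pnorm (ereal q) (r, s) = 1"
  then have "((r powr q + s powr q) powr (1 / q)) powr q = 1"
    using assms by (simp add: pnorm_def)
  then show "r powr q + s powr q = 1"
    using assms by (simp add: powr_powr)
qed (use assms in \<open>simp add: pnorm_def\<close>)

text \<open>The diagonal point with p-norm one has both coordinates 2^(-1/p). They are written as
  half of the critical value so that the bound \<open>2 * c\<close> used later is that value itself;
  for infinite \<open>p\<close> the convention \<open>1 / p = 0\<close> makes both equal to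
  1.\<close>

lemma pnorm_diag:
  assumes "1 \<le> p"
  defines "M \<equiv> 2 powr real_of_ereal (1 - 1 / p)"
  shows "pnorm p (M / 2, M / 2) = 1"
proof (cases p)
  case (real q)
  then have q: "1 \<le> q" using assms by simp
  have "real_of_ereal (1 - 1 / ereal q) = 1 - 1 / q"
    using q by (simp add: one_ereal_def)
  then have "M / 2 = 2 powr (- (1 / q))"
    using real by (simp add: M_def powr_diff powr_minus_divide)
  then have "(M / 2) powr q = 1 / 2"
    using q powr_powr[of 2 "- (1 / q)" q] by (simp add: powr_minus_divide)
  then have "(M / 2) powr q + (M / 2) powr q = 1" by simp
  moreover have "0 \<le> M / 2" by (simp add: M_def)
  ultimately show ?thesis using pnorm_ereal_eq_1_iff q real by simp
qed (use assms in \<open>auto simp: pnorm_def M_def one_ereal_def\<close>)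

text \<open>By the mean value theorem on each half of the interval: the derivative
  \<open>q * z powr (q - 1)\<close> is strictly increasing because \<open>q > 1\<close>, so the
  increment over the right half exceeds the one over the left half.\<close>

lemma powr_midpoint_less:
  fixes q r s :: real
  assumes q: "1 < q" and rs: "0 \<le> r" "r < s"
  shows "2 * ((r + s) / 2) powr q < r powr q + s powr q"
proof -
  define m where "m = (r + s) / 2"
  have m: "r < m" "m < s" "m - r = s - m" using rs by (auto simp: m_def field_simps)
  have mvt: "\<exists>z. x < z \<and> z < y \<and> y powr q - x powr q = (y - x) * (q * z powr (q - 1))"
    if "0 \<le> x" "x < y" for x y
  proof -
    \<comment> \<open>The left endpoint may be 0, where continuity suffices; interior points are
      positive, so the derivative formula applies there.\<close>
    have der: "((\<lambda>x. x powr q) has_real_derivative q * z powr (q - 1)) (at z)" if "0 < z" for z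
      using that by (intro has_real_derivative_powr)
    have "continuous_on {x..y} (\<lambda>x. x powr q)"
      using \<open>0 \<le> x\<close> q by (intro continuous_on_powr' continuous_intros) auto
    moreover have "(\<lambda>x. x powr q) differentiable (at z)" if "x < z" "z < y" for z
      using der[of z] that \<open>0 \<le> x\<close> real_differentiable_def by auto
    ultimately obtain l z where z: "x < z" "z < y" "((\<lambda>x. x powr q) has_real_derivative l) (at z)"
      "y powr q - x powr q = (y - x) * l"
      using MVT[OF \<open>x < y\<close>] by blast
    moreover have "l = q * z powr (q - 1)"
      using DERIV_unique[OF z(3) der] z(1) \<open>0 \<le> x\<close> by simp
    ultimately show ?thesis by blast
  qed
  obtain y where y: "r < y" "y < m" "m powr q - r powr q = (m - r) * (q * y powr (q - 1))"
    using mvt rs m by blast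
  obtain z where z: "m < z" "z < s" "s powr q - m powr q = (s - m) * (q * z powr (q - 1))"
    using mvt[of m s] rs m by auto
  have "y powr (q - 1) < z powr (q - 1)"
    using rs y z q by (intro powr_less_mono2) auto
  then have "m powr q - r powr q < s powr q - m powr q"
    using y z m q by simp
  then show ?thesis by (simp add: m_def)
qed

text \<open>Off the diagonal, strict convexity puts the q-th power of the midpoint below 1/2, which
  is \<open>c powr q\<close>.\<close>

lemma sum_less_of_powr_sum_eq_1:
  fixes q r s c :: real
  assumes q: "1 < q" and rs: "0 \<le> r" "0 \<le> s" "r \<noteq> s"
    and eq: "r powr q + s powr q = 1" and c: "0 \<le> c" "c powr q + c powr q = 1"
  shows "r + s < 2 * c"
proof -
  have "2 * ((r + s) / 2) powr q < r powr q + s powr q"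
    using powr_midpoint_less[OF q, of r s] powr_midpoint_less[OF q, of s r] rs
    by (cases "r < s") (auto simp: add.commute)
  then have "((r + s) / 2) powr q < c powr q" using eq c by linarith
  then have "(r + s) / 2 < c"
    using q c powr_mono2[of q c "(r + s) / 2"] by linarith
  then show ?thesis by simp
qed

text \<open>Splitting off the common multiple of \<open>u + v\<close> leaves a multiple of only one
  of the two unit vectors, with coefficient \<open>\<bar>r - s\<bar>\<close>.\<close>

lemma norm_combination_le:
  fixes u v :: "'a::real_normed_vector"
  assumes "norm u = 1" "norm v = 1" "0 \<le> r" "0 \<le> s"
  shows "norm (r *\<^sub>R u + s *\<^sub>R v) \<le> min r s * norm (u + v) + \<bar>r - s\<bar>"
proof -
  define m where "m = min r s"
  have m: "0 \<le> m" "m \<le> r" "m \<le> s" "(r - m) + (s - m) = \<bar>r - s\<bar>"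
    using assms by (auto simp: m_def)
  have "r *\<^sub>R u + s *\<^sub>R v = m *\<^sub>R (u + v) + ((r - m) *\<^sub>R u + (s - m) *\<^sub>R v)"
    by (simp add: algebra_simps)
  also have "norm \<dots> \<le> norm (m *\<^sub>R (u + v)) + (norm ((r - m) *\<^sub>R u) + norm ((s - m) *\<^sub>R v))"
    by (intro norm_triangle_le add_mono order.refl norm_triangle_ineq)
  also have "\<dots> = m * norm (u + v) + \<bar>r - s\<bar>"
    using m assms by simp
  finally show ?thesis by (simp add: m_def)
qed

lemma norm_combination_diff_le:
  fixes u v :: "'a::real_normed_vector"
  assumes "norm u = 1" "norm v = 1" "0 \<le> r" "0 \<le> s"
  shows "norm (s *\<^sub>R u - r *\<^sub>R v) \<le> min r s * norm (u - v) + \<bar>r - s\<bar>"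
  using norm_combination_le[of u "- v" s r] assms
  by (simp add: min.commute abs_minus_commute)

lemma frak_C_ge_of_not_nonsquare:
  assumes f: "f \<in> Lambda_mono" and p: "1 \<le> p"
    and nonsq: "\<not> uniformly_nonsquare TYPE('a::real_normed_vector)"
  shows "2 powr real_of_ereal (1 - 1 / p) \<le> frak_C f p TYPE('a)"
proof -
  define c where "c = 2 powr real_of_ereal (1 - 1 / p) / 2"
  have c: "0 < c" by (simp add: c_def)
  have fL: "f \<in> Lambda_class" using f by (simp add: Lambda_mono_def)
  \<comment> \<open>For each \<open>t\<close> below 2 there is a pair whose sum and difference both
    have norm above \<open>t\<close>. Such pairs need not attain 2, so the bound 2 follows only by
    density, after dividing by \<open>c\<close>.\<close>
  have "t \<le> frak_C f p TYPE('a) / c" if t: "0 < t" "t < 2" for t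
  proof -
    obtain u v :: 'a where uv: "norm u = 1" "norm v = 1" "t < norm (u + v)" "t < norm (u - v)"
      using nonsq t by (fastforce simp: uniformly_nonsquare_def)
    define y where "y = f (norm (c *\<^sub>R u + c *\<^sub>R v), norm (c *\<^sub>R u - c *\<^sub>R v))"
    have "c * t = f (c * t, c * t)"
      using Lambda_class_diag[OF fL] c t by simp
    also have "\<dots> \<le> f (c * norm (u + v), c * norm (u - v))"
      using c t uv by (intro Lambda_mono_le[OF f]) auto
    also have "\<dots> = y"
      using c by (simp add: y_def flip: scaleR_add_right scaleR_diff_right)
    also have "y \<in> constant_values f p TYPE('a)"
      unfolding constant_values_def y_def using uv c pnorm_diag[OF p] by (fastforce simp: c_def)
    then have "y \<le> frak_C f p TYPE('a)"
      unfolding frak_C_def by (intro cSup_upper constant_values_bdd_above fL p)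
    finally show ?thesis using c by (simp add: field_simps)
  qed
  then have "2 \<le> frak_C f p TYPE('a) / c"
    by (intro dense_le_bounded[of 0 2]) auto
  then show ?thesis using c by (simp add: field_simps c_def)
qed

lemma frak_C_less_of_nonsquare:
  assumes nz: "\<exists>x :: 'a::real_normed_vector. x \<noteq> 0"
    and f: "f \<in> Lambda_mono" and strict: "strictly_increasing_each f"
    and nonsq: "uniformly_nonsquare TYPE('a)" and p: "1 < p" "p < \<infinity>"
  shows "frak_C f p TYPE('a) < 2 powr real_of_ereal (1 - 1 / p)"
proof -
  define c where "c = 2 powr real_of_ereal (1 - 1 / p) / 2"
  have fL: "f \<in> Lambda_class" using f by (simp add: Lambda_mono_def)
  then have cont_f: "continuous_on ({0..} \<times> {0..}) f" by (simp add: Lambda_class_def)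
  obtain q where pq: "p = ereal q" and q: "1 < q" using p by (cases p) auto
  have c: "0 \<le> c" "c powr q + c powr q = 1"
    using pnorm_diag[of p] pnorm_ereal_eq_1_iff[of q c c] pq q by (auto simp: c_def)
  obtain \<delta>0 where \<delta>0: "\<delta>0 < 2"
    "\<And>x y :: 'a. norm x = 1 \<Longrightarrow> norm y = 1 \<Longrightarrow> min (norm (x + y)) (norm (x - y)) \<le> \<delta>0"
    using nonsq by (auto simp: uniformly_nonsquare_def)
  \<comment> \<open>Truncation at 0 makes \<open>d\<close> nonnegative at once, which keeps the
    arguments of \<open>f\<close> in the quadrant where it is continuous and monotone.\<close>
  define \<delta> where "\<delta> = max 0 \<delta>0"
  have \<delta>: "0 \<le> \<delta>" "\<delta> < 2"
    "\<And>x y :: 'a. norm x = 1 \<Longrightarrow> norm y = 1 \<Longrightarrow> min (norm (x + y)) (norm (x - y)) \<le> \<delta>"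
    using \<delta>0 by (auto simp: \<delta>_def intro: max.coboundedI2)
  define d where "d = (\<lambda>(r, s). min r s * \<delta> + \<bar>r - s\<bar>)"
  \<comment> \<open>It is not known in advance which of the two norms is the small one, so
    \<open>g\<close> covers both orders.\<close>
  define g where "g = (\<lambda>(r, s). max (f (r + s, d (r, s))) (f (d (r, s), r + s)))"
  define K where "K = ({0..1} \<times> {0..1}) \<inter> {(r, s). r powr q + s powr q = 1}"
  have d_nonneg: "0 \<le> d (r, s)" if "0 \<le> r" "0 \<le> s" for r s
    using that \<delta> by (simp add: d_def)
  have d_le: "d (r, s) \<le> r + s" if "0 \<le> r" "0 \<le> s" for r s
    using that \<delta> mult_left_mono[of \<delta> 2 "min r s"] by (auto simp: d_def min_def)
  \<comment> \<open>As a level set of a continuous function on the closed square, \<open>K\<close>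
    is closed; intersecting it with the square once more yields compactness.\<close>
  have "K = {x \<in> {0..1} \<times> {0..1}. fst x powr q + snd x powr q = 1}"
    by (auto simp: K_def)
  also have "closed \<dots>"
    by (intro continuous_closed_preimage_constant continuous_on_add continuous_on_powr'
          continuous_on_fst continuous_on_snd continuous_on_id continuous_on_const closed_Times)
      (use q in auto)
  finally have "compact (({0..1} \<times> {0..1}) \<inter> K)"
    by (intro compact_Int_closed compact_Times) auto
  moreover have "({0..1} \<times> {0..1}) \<inter> K = K" by (auto simp: K_def)
  ultimately have "compact K" by simp
  moreover have "(1, 0) \<in> K" by (simp add: K_def)
  moreover have "continuous_on K g"
  proof -
    have "continuous_on K (\<lambda>x. max (f (fst x + snd x, min (fst x) (snd x) * \<delta> + \<bar>fst x - snd x\<bar>))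
        (f (min (fst x) (snd x) * \<delta> + \<bar>fst x - snd x\<bar>, fst x + snd x)))"
      by (intro continuous_on_max continuous_on_compose2[OF cont_f] continuous_intros)
        (use \<delta> in \<open>auto simp: K_def\<close>)
    then show ?thesis by (simp add: g_def d_def case_prod_beta)
  qed
  ultimately obtain r0 s0 where max: "(r0, s0) \<in> K" "\<And>r s. (r, s) \<in> K \<Longrightarrow> g (r, s) \<le> g (r0, s0)"
    using continuous_attains_sup[of K g] by fast
  have rs0: "0 \<le> r0" "0 \<le> s0" "r0 powr q + s0 powr q = 1"
    using max by (auto simp: K_def)
  have "g (r0, s0) < 2 * c"
  proof (cases "r0 = s0")
    case True
    \<comment> \<open>At 0 the powers would sum to 0 instead of 1. Positivity is what makes
      \<open>d (r0, r0) = r0 * \<delta>\<close> strictly smaller than \<open>2 * r0\<close>.\<close>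
    have "r0 \<noteq> 0" using rs0 True by auto
    then have d: "0 \<le> d (r0, r0)" "d (r0, r0) < 2 * r0"
      using rs0 \<delta> by (auto simp: d_def)
    have "r0 powr q = c powr q" using rs0 c True by simp
    then have "r0 = c" using rs0(1) c(1) q powr_less_mono2[of q r0 c] powr_less_mono2[of q c r0]
      by (cases r0 c rule: linorder_cases) auto
    have "strict_mono_on {0..} (\<lambda>a. f (a, 2 * r0))" "strict_mono_on {0..} (\<lambda>b. f (2 * r0, b))"
      using strict rs0 by (auto simp: strictly_increasing_each_def)
    \<comment> \<open>Each argument of the maximum in \<open>g\<close> has one entry
      \<open>2 * r0\<close> and one smaller entry, so strictness is used once in each
      variable.\<close>
    from strict_mono_onD[OF this(1), of "d (r0, r0)" "2 * r0"]
      strict_mono_onD[OF this(2), of "d (r0, r0)" "2 * r0"]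
    have "g (r0, s0) < f (2 * r0, 2 * r0)"
      using d rs0 True by (simp add: g_def)
    then show ?thesis using Lambda_class_diag[OF fL, of "2 * r0"] rs0 \<open>r0 = c\<close> by simp
  next
    case False
    have "g (r0, s0) \<le> f (r0 + s0, r0 + s0)"
      using rs0 d_nonneg d_le by (auto simp: g_def intro!: Lambda_mono_le[OF f])
    also have "\<dots> = r0 + s0" using rs0 by (intro Lambda_class_diag[OF fL]) simp
    also have "\<dots> < 2 * c" using sum_less_of_powr_sum_eq_1 q rs0 c False by blast
    finally show ?thesis .
  qed
  moreover have "frak_C f p TYPE('a) \<le> g (r0, s0)"
    unfolding frak_C_def
  proof (rule cSup_least)
    show "constant_values f p TYPE('a) \<noteq> {}"
      using nz p by (intro constant_values_nonempty) auto
  next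
    fix y assume "y \<in> constant_values f p TYPE('a)"
    then obtain u v :: 'a and r s where y:
      "y = f (norm (r *\<^sub>R u + s *\<^sub>R v), norm (s *\<^sub>R u - r *\<^sub>R v))"
      "norm u = 1" "norm v = 1" "0 \<le> r" "0 \<le> s" "pnorm p (r, s) = 1"
      by (auto simp: constant_values_def)
    define a b where "a = norm (r *\<^sub>R u + s *\<^sub>R v)" and "b = norm (s *\<^sub>R u - r *\<^sub>R v)"
    have "(r, s) \<in> K"
      using y pq q p pnorm_eq_1_le[of p r s] by (auto simp: K_def pnorm_ereal_eq_1_iff)
    have ab: "0 \<le> a" "a \<le> r + s" "0 \<le> b" "b \<le> r + s"
      using y norm_triangle_ineq[of "r *\<^sub>R u" "s *\<^sub>R v"]
        norm_triangle_ineq4[of "s *\<^sub>R u" "r *\<^sub>R v"] by (auto simp: a_def b_def)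
    have "a \<le> min r s * norm (u + v) + \<bar>r - s\<bar>" "b \<le> min r s * norm (u - v) + \<bar>r - s\<bar>"
      using y norm_combination_le[of u v r s] norm_combination_diff_le[of u v r s]
      by (auto simp: a_def b_def)
    moreover have "norm (u + v) \<le> \<delta> \<or> norm (u - v) \<le> \<delta>"
      using \<delta>(3)[of u v] y by (auto simp: min_le_iff_disj)
    then have "min r s * norm (u + v) \<le> min r s * \<delta> \<or> min r s * norm (u - v) \<le> min r s * \<delta>"
      using y by (auto intro!: mult_left_mono)
    ultimately have "a \<le> d (r, s) \<or> b \<le> d (r, s)"
      by (auto simp: d_def)
    \<comment> \<open>Whichever norm is at most \<open>d (r, s)\<close>, the other is at most
      \<open>r + s\<close>, and monotonicity compares with the matching argument of the
      maximum.\<close>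
    then have "f (a, b) \<le> g (r, s)"
      using ab by (auto simp: g_def intro: max.coboundedI1 max.coboundedI2 Lambda_mono_le[OF f])
    also have "\<dots> \<le> g (r0, s0)" using max \<open>(r, s) \<in> K\<close> by blast
    finally show "y \<le> g (r0, s0)" by (simp add: y a_def b_def)
  qed
  ultimately show ?thesis by (simp add: c_def)
qed

theorem theorem16:
  fixes f :: "real \<times> real \<Rightarrow> real"
  assumes "\<exists>B :: 'a::real_normed_vector set. independent B \<and> card B = 2"
    and "f \<in> Lambda_mono"
  shows "(\<forall>p::ereal. 1 \<le> p \<longrightarrow> frak_C f p TYPE('a) < 2 powr real_of_ereal (1 - 1 / p)
            \<longrightarrow> uniformly_nonsquare TYPE('a))
       \<and> (strictly_increasing_each f \<longrightarrow> uniformly_nonsquare TYPE('a) \<longrightarrow>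
            (\<forall>p::ereal. 1 < p \<and> p < \<infinity> \<longrightarrow>
               frak_C f p TYPE('a) < 2 powr real_of_ereal (1 - 1 / p)))"
proof -
  obtain B :: "'a set" where B: "independent B" "card B = 2" using assms(1) by blast
  \<comment> \<open>A member of an independent set is nonzero; this makes the set of values
    nonempty, as the upper bound on its supremum requires.\<close>
  then obtain b where "b \<in> B" by fastforce
  with B(1) have "b \<noteq> 0" using dependent_zero[of B] by metis
  then have nz: "\<exists>x :: 'a. x \<noteq> 0" ..
  show ?thesis
  proof (intro conjI allI impI)
    fix p :: ereal
    assume "1 \<le> p" "frak_C f p TYPE('a) < 2 powr real_of_ereal (1 - 1 / p)"
    then show "uniformly_nonsquare TYPE('a)"
      using frak_C_ge_of_not_nonsquare[OF assms(2) \<open>1 \<le> p\<close>] linorder_not_le by blast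
  next
    fix p :: ereal
    assume "strictly_increasing_each f" "uniformly_nonsquare TYPE('a)" "1 < p \<and> p < \<infinity>"
    then show "frak_C f p TYPE('a) < 2 powr real_of_ereal (1 - 1 / p)"
      using frak_C_less_of_nonsquare[OF nz assms(2)] by blast
  qed
qed

end
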